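(* Let $R$ be a ring, and let $a,b,c,d\in R$ satisfy $bdb=bac$ and $dbd=acd$. If $ac$ has generalized Zhou inverse, then $bd$ has generalized Zhou inverse. In this case, $(bd)^{z}=b\big((ac)^{z}\big)^2d$.
   Context: All rings are associative with identity $1$ (not necessarily commutative). $\mathbb{N}$ denotes the positive integers. $J(R)$ is the Jacobson radical of $R$ and $\sqrt{J(R)}=\{x\in R : x^m\in J(R)\text{ for some } m\in\mathbb{N}\}$. For $x\in R$, $comm(x)=\{y\in R: yx=xy\}$ and $comm^2(x)=\{y\in R: yw=wy\text{ for all }w\in comm(x)\}$. An element $x\in R$ has generalized Zhou inverse if there exists $y\in R$ such that $y=yxy$, $y\in comm^2(x)$ and $x^n-xy\in\sqrt{J(R)}$ for some $n\in\mathbb{N}$. Such $y$ is unique if it exists; it is denoted $x^{z}$ and called the generalized Zhou inverse of $x$. *)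

theory Defs
  imports Main
begin

text \<open>
  The sort \<open>{ring, monoid_mult}\<close> is that of associative, not necessarily commutative rings
  with identity. The class \<open>ring_1\<close> would additionally demand \<open>0 \<noteq> 1\<close> and so exclude
  the zero ring.
\<close>

definition left_ideal :: "'a::{ring, monoid_mult} set \<Rightarrow> bool" where
  "left_ideal I \<longleftrightarrow>
     0 \<in> I \<and> (\<forall>x\<in>I. \<forall>y\<in>I. x + y \<in> I) \<and> (\<forall>r. \<forall>x\<in>I. r * x \<in> I)"

definition maximal_left_ideal :: "'a::{ring, monoid_mult} set \<Rightarrow> bool" where
  "maximal_left_ideal I \<longleftrightarrow>
     left_ideal I \<and> I \<noteq> UNIV \<and> (\<forall>K. left_ideal K \<and> I \<subseteq> K \<longrightarrow> K = I \<or> K = UNIV)"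

text \<open>In the zero ring there is no maximal left ideal, and the intersection is the whole ring.\<close>

definition jacobson_radical :: "'a::{ring, monoid_mult} set" where
  "jacobson_radical = \<Inter> {I. maximal_left_ideal I}"

definition sqrt_jacobson :: "'a::{ring, monoid_mult} set" where
  "sqrt_jacobson = {x. \<exists>m::nat. m > 0 \<and> x ^ m \<in> jacobson_radical}"

definition comm :: "'a::{ring, monoid_mult} \<Rightarrow> 'a set" where
  "comm x = {y. y * x = x * y}"

definition comm2 :: "'a::{ring, monoid_mult} \<Rightarrow> 'a set" where
  "comm2 x = {y. \<forall>w\<in>comm x. y * w = w * y}"

definition is_gen_zhou_inverse :: "'a::{ring, monoid_mult} \<Rightarrow> 'a \<Rightarrow> bool" where
  "is_gen_zhou_inverse x y \<longleftrightarrow>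
     y = y * x * y \<and> y \<in> comm2 x \<and> (\<exists>n::nat. n > 0 \<and> x ^ n - x * y \<in> sqrt_jacobson)"

definition has_gen_zhou_inverse :: "'a::{ring, monoid_mult} \<Rightarrow> bool" where
  "has_gen_zhou_inverse x \<longleftrightarrow> (\<exists>y. is_gen_zhou_inverse x y)"

text \<open>
  Meaningful only when \<open>has_gen_zhou_inverse x\<close> holds; the inverse is then unique.
\<close>

definition gen_zhou_inverse :: "'a::{ring, monoid_mult} \<Rightarrow> 'a" where
  "gen_zhou_inverse x = (THE y. is_gen_zhou_inverse x y)"

end

theory Submission imports Defs begin

text \<open>
  Write \<open>x = a c\<close>. The factors \<open>a\<close> and \<open>c\<close> enter only through \<open>x\<close>, and the two hypotheses become
  \<open>b d b = b x\<close> and \<open>d b d = x d\<close>: the elements \<open>b d\<close> and \<open>x\<close> are intertwined by \<open>b\<close> in one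
  direction and by \<open>d\<close> in the other. Consequently \<open>d w b\<close> commutes with \<open>x\<close> whenever \<open>w\<close>
  commutes with \<open>b d\<close>; in particular (\<open>w = 1\<close>) \<open>d b\<close> commutes with \<open>x\<close>. Since a generalized Zhou
  inverse \<open>z\<close> of \<open>x\<close> lies in the double commutant of \<open>x\<close>, it commutes with all these elements \<open>d w b\<close>,
  and this turns \<open>y = b z\<^sup>2 d\<close> into an outer inverse of \<open>b d\<close> in the double commutant of \<open>b d\<close>.

  For the radical condition, \<open>(b d)\<^sup>n - b d y = b u d\<close> with \<open>u = x\<^sup>n\<^sup>-\<^sup>1 - z\<close>. As \<open>u\<close> commutes with
  \<open>d b\<close> and with \<open>x\<close>, the powers of \<open>b u d\<close> are \<open>(b u d)\<^sup>k\<^sup>+\<^sup>1 = b u (x u)\<^sup>k d\<close>, and \<open>x u = x\<^sup>n - x z\<close> has a power in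
  the Jacobson radical. The radical is a two-sided ideal, so \<open>b u d\<close> has a power in it too
  (\<open>gen_zhou_inverse_intertwined\<close>).

  The formula for the inverse then follows from uniqueness (\<open>is_gen_zhou_inverse_unique\<close>). Two
  generalized Zhou inverses of \<open>x\<close> give commuting idempotents \<open>e = x y\<close> and \<open>f = x y'\<close>, and
  \<open>e (1 - f)\<close> turns out to lie in the radical, which contains no nonzero idempotent; by symmetry
  \<open>e = f\<close>, whence \<open>y = y'\<close>.
\<close>

section \<open>The Jacobson radical\<close>

lemma left_idealD:
  assumes "left_ideal I"
  shows "0 \<in> I" "\<And>x y. x \<in> I \<Longrightarrow> y \<in> I \<Longrightarrow> x + y \<in> I" "\<And>r x. x \<in> I \<Longrightarrow> r * x \<in> I"
  using assms unfolding left_ideal_def by auto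

text \<open>The preimage of \<open>M\<close> under right multiplication by \<open>r\<close> is the annihilator of the class of \<open>r\<close>
  in the simple module \<open>R / M\<close>; that class is a generator because \<open>r \<notin> M\<close>, so the annihilator is
  again maximal.\<close>

lemma maximal_left_ideal_colon:
  fixes M :: "'a::{ring, monoid_mult} set"
  assumes M: "maximal_left_ideal M" and r: "r \<notin> M"
  shows "maximal_left_ideal {s. s * r \<in> M}"
proof -
  have lM: "left_ideal M"
    and maxM: "\<And>K. left_ideal K \<Longrightarrow> M \<subseteq> K \<Longrightarrow> K = M \<or> K = UNIV"
    using M unfolding maximal_left_ideal_def by auto
  let ?K = "{s. s * r \<in> M}"
  have "left_ideal ?K"
    using left_idealD[OF lM] unfolding left_ideal_def by (auto simp: algebra_simps)
  moreover have "1 \<notin> ?K" using r by simp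
  moreover have "L = UNIV" if L: "left_ideal L" "?K \<subseteq> L" "L \<noteq> ?K" for L
  proof -
    obtain e where e: "e \<in> L" "e * r \<notin> M" using L by auto
    let ?N = "{m + s * (e * r) | m s. m \<in> M}"
    have "left_ideal ?N"
      unfolding left_ideal_def
    proof (intro conjI ballI allI)
      show "0 \<in> ?N" using left_idealD(1)[OF lM] by (force intro: exI[of _ 0])
    next
      fix p q assume "p \<in> ?N" "q \<in> ?N"
      then obtain m s m' s' where "p = m + s * (e * r)" "q = m' + s' * (e * r)" "m \<in> M" "m' \<in> M"
        by auto
      then have "p + q = (m + m') + (s + s') * (e * r)" "m + m' \<in> M"
        using left_idealD(2)[OF lM] by (auto simp: algebra_simps)
      then show "p + q \<in> ?N" by blast
    next
      fix t p assume "p \<in> ?N"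
      then obtain m s where "p = m + s * (e * r)" "m \<in> M" by auto
      then have "t * p = t * m + (t * s) * (e * r)" "t * m \<in> M"
        using left_idealD(3)[OF lM] by (auto simp: algebra_simps)
      then show "t * p \<in> ?N" by blast
    qed
    moreover have "M \<subseteq> ?N" by (force intro: exI[of _ 0])
    moreover have "e * r \<in> ?N"
      using left_idealD(1)[OF lM] by (force intro: exI[of _ 0] exI[of _ 1])
    ultimately have N: "?N = UNIV" using maxM[of ?N] e(2) by blast
    have "t \<in> L" for t
    proof -
      obtain m s where "t * r = m + s * (e * r)" "m \<in> M" using N by blast
      then have "(t - s * e) * r \<in> M" by (simp add: algebra_simps)
      then have "t - s * e \<in> L" using L(2) by blast
      then have "(t - s * e) + s * e \<in> L" using left_idealD[OF L(1)] e(1) by blast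
      then show "t \<in> L" by simp
    qed
    then show ?thesis by blast
  qed
  ultimately show ?thesis unfolding maximal_left_ideal_def by blast
qed

lemma jacobson_radical_mult_left:
  assumes "x \<in> jacobson_radical"
  shows "r * x \<in> jacobson_radical"
  using assms unfolding jacobson_radical_def maximal_left_ideal_def
  by (auto intro: left_idealD(3))

lemma jacobson_radical_mult_right:
  assumes x: "x \<in> jacobson_radical"
  shows "x * r \<in> jacobson_radical"
  unfolding jacobson_radical_def
proof (intro InterI, clarify)
  fix M :: "'a set" assume M: "maximal_left_ideal M"
  show "x * r \<in> M"
  proof (cases "r \<in> M")
    case True
    then show ?thesis using M left_idealD(3) unfolding maximal_left_ideal_def by blast
  next
    case False
    then show ?thesis
      using maximal_left_ideal_colon[OF M False] x unfolding jacobson_radical_def by blast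
  qed
qed

lemma proper_left_ideal_extends_to_maximal:
  fixes I :: "'a::{ring, monoid_mult} set"
  assumes I: "left_ideal I" and one: "1 \<notin> I"
  obtains M where "maximal_left_ideal M" "I \<subseteq> M"
proof -
  have eq_UNIV: "K = UNIV" if "left_ideal K" "1 \<in> K" for K :: "'a set"
    using left_idealD(3)[OF that] by auto
  let ?A = "{K. left_ideal K \<and> I \<subseteq> K \<and> 1 \<notin> K}"
  have "\<exists>M\<in>?A. \<forall>X\<in>?A. M \<subseteq> X \<longrightarrow> X = M"
  proof (rule subset_Zorn_nonempty)
    show "?A \<noteq> {}" using I one by blast
  next
    fix C assume C: "C \<noteq> {}" "subset.chain ?A C"
    have "left_ideal (\<Union> C)"
      unfolding left_ideal_def
    proof (intro conjI ballI allI)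
      show "0 \<in> \<Union> C" using C left_idealD(1) unfolding subset_chain_def by fast
    next
      fix x y assume "x \<in> \<Union> C" "y \<in> \<Union> C"
      then obtain K where "K \<in> C" "x \<in> K" "y \<in> K"
        using C(2) unfolding subset_chain_def by blast
      then show "x + y \<in> \<Union> C"
        using C(2) left_idealD(2) unfolding subset_chain_def by blast
    next
      fix r x assume "x \<in> \<Union> C"
      then show "r * x \<in> \<Union> C" using C(2) left_idealD(3) unfolding subset_chain_def by blast
    qed
    then show "\<Union> C \<in> ?A" using C unfolding subset_chain_def by blast
  qed
  then obtain M where "M \<in> ?A" and max: "\<forall>K\<in>?A. M \<subseteq> K \<longrightarrow> K = M" by (rule bexE)
  then have M: "left_ideal M" "I \<subseteq> M" "1 \<notin> M" by auto
  have "K = M \<or> K = UNIV" if "left_ideal K" "M \<subseteq> K" for K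
  proof (cases "1 \<in> K")
    case True
    then show ?thesis using eq_UNIV that(1) by blast
  next
    case False
    then have "K \<in> ?A" using that M(2) by auto
    then show ?thesis using max that(2) by blast
  qed
  then have "maximal_left_ideal M"
    unfolding maximal_left_ideal_def using M by blast
  with M(2) show thesis using that by blast
qed

text \<open>If \<open>g\<close> is in the radical, no maximal left ideal contains \<open>1 - g\<close>, as it would contain \<open>1\<close>. So
  \<open>1 - g\<close> has a left inverse \<open>s\<close>, and \<open>g = s (1 - g) g = 0\<close> for idempotent \<open>g\<close>.\<close>

lemma idempotent_in_jacobson_radical_eq_0:
  fixes g :: "'a::{ring, monoid_mult}"
  assumes g: "g \<in> jacobson_radical" and idem: "g * g = g"
  shows "g = 0"
proof -
  let ?I = "{s * (1 - g) | s. True}"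
  have I: "left_ideal ?I"
    unfolding left_ideal_def
  proof (intro conjI ballI allI)
    show "0 \<in> ?I" by (force intro: exI[of _ 0])
  next
    fix x y assume "x \<in> ?I" "y \<in> ?I"
    then obtain s t where "x = s * (1 - g)" "y = t * (1 - g)" by blast
    then have "x + y = (s + t) * (1 - g)" by (simp only: distrib_right)
    then show "x + y \<in> ?I" by blast
  next
    fix r x assume "x \<in> ?I"
    then obtain s where "x = s * (1 - g)" by blast
    then have "r * x = (r * s) * (1 - g)" by (simp only: mult.assoc)
    then show "r * x \<in> ?I" by blast
  qed
  have "1 \<in> ?I"
  proof (rule ccontr)
    assume "1 \<notin> ?I"
    then obtain M where M: "maximal_left_ideal M" "?I \<subseteq> M"
      using proper_left_ideal_extends_to_maximal[OF I] by blast
    then have lM: "left_ideal M" "M \<noteq> UNIV" unfolding maximal_left_ideal_def by auto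
    have "1 * (1 - g) \<in> M" using M(2) by blast
    moreover have "g \<in> M" using g M(1) unfolding jacobson_radical_def by blast
    ultimately have "1 * (1 - g) + g \<in> M" using left_idealD(2)[OF lM(1)] by blast
    then have "1 \<in> M" by simp
    then have "r * 1 \<in> M" for r using left_idealD(3)[OF lM(1)] by blast
    then show False using lM(2) by auto
  qed
  then obtain s where s: "1 = s * (1 - g)" by blast
  have "g = s * (1 - g) * g" using s by simp
  also have "\<dots> = s * (g - g * g)" by (simp add: algebra_simps)
  finally show ?thesis using idem by simp
qed

section \<open>Powers of commuting elements\<close>

lemma power_mult_commuting:
  fixes p q :: "'a::monoid_mult"
  assumes "p * q = q * p"
  shows "(p * q) ^ k = p ^ k * q ^ k"
proof (induction k)
  case (Suc k)
  have "(p * q) ^ Suc k = p * (q * p ^ k) * q ^ k"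
    using Suc by (simp add: mult.assoc)
  also have "q * p ^ k = p ^ k * q" using power_commuting_commutes[OF assms] by simp
  finally show ?case by (simp add: mult.assoc)
qed simp

lemma idempotent_power:
  fixes p :: "'a::monoid_mult"
  assumes "p * p = p" "k > 0"
  shows "p ^ k = p"
proof -
  have "p ^ Suc j = p" for j by (induction j) (use assms(1) in auto)
  then show ?thesis using assms(2) by (cases k) auto
qed

section \<open>Uniqueness of the generalized Zhou inverse\<close>

lemma comm2_commutes: "y \<in> comm2 x \<Longrightarrow> w * x = x * w \<Longrightarrow> y * w = w * y"
  unfolding comm2_def comm_def by blast

text \<open>Let \<open>e = x y\<close>, \<open>f = x y'\<close>, \<open>g = e (1 - f)\<close> and \<open>q = x\<^sup>k - f\<close> with \<open>q\<^sup>m\<close> in the radical.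
  Since \<open>g f = 0\<close>, also \<open>g q\<^sup>m = g x\<^sup>k\<^sup>m\<close> is in the radical. Multiplying by \<open>y\<^sup>k\<^sup>m\<close> turns \<open>x\<^sup>k\<^sup>m\<close> into
  the idempotent \<open>e\<close>, and \<open>g e = g\<close>. So the idempotent \<open>g\<close> is in the radical, hence zero.\<close>

lemma gen_zhou_idempotent_absorb:
  fixes x y y' :: "'a::{ring, monoid_mult}"
  assumes "is_gen_zhou_inverse x y" "is_gen_zhou_inverse x y'"
  shows "(x * y) * (x * y') = x * y"
proof -
  have y: "y = y * x * y" "y \<in> comm2 x" and y': "y' = y' * x * y'" "y' \<in> comm2 x"
    using assms unfolding is_gen_zhou_inverse_def by auto
  obtain k m where km: "k > 0" "m > 0" "(x ^ k - x * y') ^ m \<in> jacobson_radical"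
    using assms(2) unfolding is_gen_zhou_inverse_def sqrt_jacobson_def by blast
  have xy: "y * x = x * y" and xy': "y' * x = x * y'"
    using comm2_commutes[OF y(2), of x] comm2_commutes[OF y'(2), of x] by auto
  have yy': "y * y' = y' * y" by (rule comm2_commutes[OF y(2) xy'])
  define e f g q where "e = x * y" and "f = x * y'" and "g = e - e * f" and "q = x ^ k - f"
  have ee: "e * e = e" unfolding e_def using y(1) by (metis mult.assoc)
  have ff: "f * f = f" unfolding f_def using y'(1) by (metis mult.assoc)
  have ef: "e * f = f * e" unfolding e_def f_def using xy xy' yy' by (metis mult.assoc)
  have xe: "x * e = e * x" unfolding e_def using xy by (metis mult.assoc)
  have xf: "x * f = f * x" unfolding f_def using xy' by (metis mult.assoc)
  have eff: "e * f * f = e * f" using ff by (simp add: mult.assoc)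
  have efe: "e * f * e = e * f" using ee ef by (metis mult.assoc)
  have gg: "g * g = g"
    unfolding g_def using ee efe eff
    by (simp add: left_diff_distrib right_diff_distrib mult.assoc[symmetric])
  have gf: "g * f = 0" unfolding g_def by (simp add: left_diff_distrib eff)
  have xg: "x * g = g * x"
    unfolding g_def left_diff_distrib right_diff_distrib using xe xf by (metis mult.assoc)
  have fg: "f * g = 0"
    unfolding g_def right_diff_distrib using ef eff by (metis mult.assoc diff_self)
  have xkg: "x ^ k * g = g * x ^ k" by (rule power_commuting_commutes[OF xg])
  have gq: "g * q = g * x ^ k" unfolding q_def by (simp add: right_diff_distrib gf)
  have qg: "q * g = g * q"
    unfolding q_def by (simp add: right_diff_distrib left_diff_distrib gf fg xkg)
  have "g * q ^ m = (g * q) ^ m"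
    using power_mult_commuting[of g q m] qg idempotent_power[OF gg km(2)] by simp
  also have "\<dots> = g * x ^ (k * m)"
    using power_mult_commuting[of g "x ^ k" m] xkg gq idempotent_power[OF gg km(2)]
    by (simp add: power_mult)
  finally have "g * x ^ (k * m) \<in> jacobson_radical"
    using jacobson_radical_mult_left km(3) unfolding q_def f_def by metis
  then have "g * x ^ (k * m) * y ^ (k * m) \<in> jacobson_radical"
    by (rule jacobson_radical_mult_right)
  also have "g * x ^ (k * m) * y ^ (k * m) = g * e ^ (k * m)"
    unfolding e_def using power_mult_commuting[of x y "k * m"] xy by (simp add: mult.assoc)
  also have "\<dots> = g"
    using idempotent_power[OF ee, of "k * m"] km unfolding g_def
    by (simp add: left_diff_distrib ee efe)
  finally have "g = 0" using idempotent_in_jacobson_radical_eq_0 gg by blast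
  then show ?thesis unfolding g_def e_def f_def by simp
qed

lemma is_gen_zhou_inverse_unique:
  assumes "is_gen_zhou_inverse x y" "is_gen_zhou_inverse x y'"
  shows "y = y'"
proof -
  have y: "y = y * x * y" "y \<in> comm2 x" and y': "y' = y' * x * y'" "y' \<in> comm2 x"
    using assms unfolding is_gen_zhou_inverse_def by auto
  have xy: "y * x = x * y" and xy': "y' * x = x * y'"
    using comm2_commutes[OF y(2), of x] comm2_commutes[OF y'(2), of x] by auto
  have yy': "y * y' = y' * y" by (rule comm2_commutes[OF y(2) xy'])
  have "(x * y) * (x * y') = (x * y') * (x * y)" using xy xy' yy' by (metis mult.assoc)
  then have e: "x * y = x * y'"
    using gen_zhou_idempotent_absorb[OF assms] gen_zhou_idempotent_absorb[OF assms(2,1)] by simp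
  have "y = y * (x * y')" using y(1) e by (simp add: mult.assoc)
  also have "\<dots> = x * y * y'" using xy by (simp add: mult.assoc[symmetric])
  also have "\<dots> = y'" using e xy' y'(1) by simp
  finally show ?thesis .
qed

lemma gen_zhou_inverse_eqI:
  assumes "is_gen_zhou_inverse x y"
  shows "gen_zhou_inverse x = y"
  unfolding gen_zhou_inverse_def
  using assms is_gen_zhou_inverse_unique by blast

section \<open>Intertwined elements\<close>

lemma intertwined_power:
  fixes b x :: "'a::monoid_mult"
  assumes "p * b = b * x"
  shows "p ^ k * b = b * x ^ k"
proof (induction k)
  case (Suc k)
  have "p ^ Suc k * b = p * (p ^ k * b)" by (simp add: mult.assoc)
  also have "\<dots> = p * b * x ^ k" using Suc by (simp add: mult.assoc)
  finally show ?case using assms by (simp add: mult.assoc)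
qed simp

text \<open>An analogue of Cline's formula; the classical case is \<open>x = d b\<close>.\<close>

lemma gen_zhou_inverse_intertwined:
  fixes b d x z :: "'a::{ring, monoid_mult}"
  assumes bdb: "b * d * b = b * x" and dbd: "d * b * d = x * d"
    and "is_gen_zhou_inverse x z"
  shows "is_gen_zhou_inverse (b * d) (b * z\<^sup>2 * d)"
proof -
  have zxz: "z = z * x * z" and z2: "z \<in> comm2 x"
    using assms(3) unfolding is_gen_zhou_inverse_def by auto
  obtain n m where nm: "n > 0" "m > 0" "(x ^ n - x * z) ^ m \<in> jacobson_radical"
    using assms(3) unfolding is_gen_zhou_inverse_def sqrt_jacobson_def by blast
  have zx: "z * x = x * z" using comm2_commutes[OF z2, of x] by simp
  have xzz: "x * z\<^sup>2 = z" using zxz zx by (simp add: power2_eq_square mult.assoc[symmetric])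
  have zzx: "z\<^sup>2 * x = z" using zxz zx by (metis power2_eq_square mult.assoc)

  \<comment> \<open>The hypotheses as rewrite rules for products that are associated to the right.\<close>
  have bdb': "b * (d * b) = b * x" "b * (d * (b * t)) = b * (x * t)" for t
    using bdb by (metis mult.assoc)+
  have dbd': "d * (b * d) = x * d" "d * (b * (d * t)) = x * (d * t)" for t
    using dbd by (metis mult.assoc)+

  have key: "z * (d * w * b) = (d * w * b) * z" if w: "w * (b * d) = (b * d) * w" for w
  proof (rule comm2_commutes[OF z2])
    have w': "w * (b * (d * t)) = b * (d * (w * t))" for t
      using w by (metis mult.assoc)
    have "d * w * b * x = d * w * (b * d * b)" by (simp add: bdb' mult.assoc)
    also have "\<dots> = d * (w * (b * d)) * b" by (simp add: mult.assoc)
    also have "\<dots> = (d * b * d) * w * b" by (simp add: w' mult.assoc)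
    also have "\<dots> = x * (d * w * b)" by (simp add: dbd' mult.assoc)
    finally show "d * w * b * x = x * (d * w * b)" .
  qed
  have zdb: "z * (d * b) = d * b * z" using key[of 1] by simp
  have xdb: "x * (d * b) = d * b * x"
    using bdb dbd by (metis mult.assoc)

  define y where "y = b * z\<^sup>2 * d"
  have py: "b * d * y = b * z * d"
  proof -
    have "b * d * y = (b * d * b) * z\<^sup>2 * d" unfolding y_def by (simp add: mult.assoc)
    also have "\<dots> = b * (x * z\<^sup>2) * d" by (simp add: bdb' mult.assoc)
    finally show ?thesis by (simp add: xzz)
  qed

  have outer: "y = y * (b * d) * y"
  proof -
    have "y * (b * d) * y = b * z\<^sup>2 * (d * b * z) * d"
      using py unfolding y_def by (simp add: mult.assoc)
    also have "d * b * z = z * (d * b)" by (simp add: zdb)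
    also have "b * z\<^sup>2 * (z * (d * b)) * d = b * z\<^sup>2 * z * (d * b * d)" by (simp add: mult.assoc)
    also have "\<dots> = b * z\<^sup>2 * (z * x) * d" by (simp add: dbd' mult.assoc)
    also have "\<dots> = b * z * (z\<^sup>2 * x) * d" by (simp add: power2_eq_square mult.assoc)
    also have "\<dots> = y" unfolding y_def zzx by (simp add: power2_eq_square mult.assoc)
    finally show ?thesis by simp
  qed

  have double_comm: "y \<in> comm2 (b * d)"
    unfolding comm2_def comm_def
  proof (intro CollectI ballI, drule CollectD)
    fix w assume w: "w * (b * d) = b * d * w"
    have c: "z ^ 3 * (d * w * b) = (d * w * b) * z ^ 3"
      by (rule power_commuting_commutes[OF key[OF w]])
    have z3: "z ^ 3 * x = z\<^sup>2" "x * z ^ 3 = z\<^sup>2"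
      using zzx xzz by (metis power3_eq_cube power2_eq_square mult.assoc)+
    \<comment> \<open>Trading \<open>z\<^sup>2\<close> for \<open>z\<^sup>3 x\<close> produces the factor \<open>b d\<close> past which \<open>w\<close> can be moved.\<close>
    have "y * w = b * z ^ 3 * (x * d) * w"
      unfolding y_def z3(1)[symmetric] by (simp add: mult.assoc)
    also have "\<dots> = b * z ^ 3 * d * (b * d * w)" by (simp add: dbd' mult.assoc)
    also have "\<dots> = b * z ^ 3 * d * (w * (b * d))" by (simp only: w)
    also have "\<dots> = b * (z ^ 3 * (d * w * b)) * d" by (simp add: mult.assoc)
    also have "\<dots> = ((b * d) * w) * b * z ^ 3 * d" by (simp only: c) (simp only: mult.assoc)
    also have "\<dots> = w * (b * d * b) * z ^ 3 * d"
      by (simp only: w[symmetric]) (simp only: mult.assoc)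
    also have "\<dots> = w * b * (x * z ^ 3) * d" by (simp add: bdb' mult.assoc)
    also have "\<dots> = w * y" unfolding y_def z3(2) by (simp add: mult.assoc)
    finally show "y * w = w * y" .
  qed

  define u where "u = x ^ (n - 1) - z"
  have n: "n = Suc (n - 1)" using nm(1) by simp
  have xu: "x * u = x ^ n - x * z"
    unfolding u_def by (subst n) (simp add: right_diff_distrib)
  have ux: "u * x = x * u"
    unfolding u_def by (simp add: right_diff_distrib left_diff_distrib zx power_commutes)
  have udb: "u * (d * b) = d * b * u"
    unfolding u_def left_diff_distrib right_diff_distrib
    using zdb power_commuting_commutes[OF xdb] by simp
  have rest: "(b * d) ^ n - b * d * y = b * u * d"
  proof -
    have "(b * d) ^ n = (b * d) ^ (n - 1) * (b * d)"
      by (subst n) (simp only: power_Suc2)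
    also have "\<dots> = b * x ^ (n - 1) * d"
      using intertwined_power[OF bdb, of "n - 1"] by (simp add: mult.assoc[symmetric])
    finally show ?thesis
      unfolding u_def py by (simp add: right_diff_distrib left_diff_distrib)
  qed
  have pow: "(b * u * d) ^ Suc k = b * (u * (x * u) ^ k) * d" for k
  proof (induction k)
    case (Suc k)
    have "(b * u * d) ^ Suc (Suc k) = (b * u * d) * (b * (u * (x * u) ^ k) * d)"
      using Suc by simp
    also have "\<dots> = b * (u * (d * b)) * (u * (x * u) ^ k) * d" by (simp add: mult.assoc)
    also have "\<dots> = (b * d * b) * u * (u * (x * u) ^ k) * d"
      by (simp only: udb) (simp only: mult.assoc)
    also have "\<dots> = b * (x * u * u) * (x * u) ^ k * d" by (simp add: bdb' mult.assoc)
    also have "x * u * u = u * (x * u)" by (simp add: ux[symmetric] mult.assoc)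
    also have "b * (u * (x * u)) * (x * u) ^ k * d = b * (u * (x * u) ^ Suc k) * d"
      by (simp add: mult.assoc)
    finally show ?case .
  qed simp
  have "(b * u * d) ^ Suc m \<in> jacobson_radical"
    unfolding pow xu
    by (intro jacobson_radical_mult_right jacobson_radical_mult_left nm(3))
  then have "(b * d) ^ n - b * d * y \<in> sqrt_jacobson"
    unfolding rest sqrt_jacobson_def by blast
  with nm(1) outer double_comm show ?thesis
    unfolding is_gen_zhou_inverse_def y_def by blast
qed

theorem theorem3p1:
  fixes a b c d :: "'a::{ring, monoid_mult}"
  assumes "b * d * b = b * a * c"
    and "d * b * d = a * c * d"
    and "has_gen_zhou_inverse (a * c)"
  shows "has_gen_zhou_inverse (b * d) \<and>
         gen_zhou_inverse (b * d) = b * (gen_zhou_inverse (a * c))\<^sup>2 * d"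
proof -
  obtain z where z: "is_gen_zhou_inverse (a * c) z"
    using assms(3) unfolding has_gen_zhou_inverse_def by blast
  have "is_gen_zhou_inverse (b * d) (b * z\<^sup>2 * d)"
    using gen_zhou_inverse_intertwined[OF _ assms(2) z] assms(1) by (simp add: mult.assoc)
  then show ?thesis
    using gen_zhou_inverse_eqI z unfolding has_gen_zhou_inverse_def by blast
qed

end
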